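(* Let $\mathcal{X}$ and $\mathcal{I}$ be finite nonempty sets, let $\{C_i\}_{i\in\mathcal{I}}$ be a family of channels with input set $\mathcal{X}$, and let $\mu$ be a probability distribution on $\mathcal{I}$. Then, for every probability distribution $\pi$ on $\mathcal{X}$ and every vulnerability $\mathbb{V}:\mathbb{D}\mathcal{X}\to\mathbb{R}$: (a) (posterior vulnerability is convex with respect to hidden choice) if all $C_i$ have the same type, then $$\mathbb{V}\Big[\pi,\bigoplus_{i\leftarrow\mu}C_i\Big]\le\sum_{i\in\mathcal{I}}\mu(i)\,\mathbb{V}[\pi,C_i];$$ (b) (posterior vulnerability is linear with respect to visible choice) if all $C_i$ are compatible, then $$\mathbb{V}\Big[\pi,\bigsqcup_{i\leftarrow\mu}C_i\Big]=\sum_{i\in\mathcal{I}}\mu(i)\,\mathbb{V}[\pi,C_i].$$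
   Context: All input and output sets are finite and nonempty. A channel of type $\mathcal{X}\times\mathcal{Y}\to\mathbb{R}$ is a matrix $C:\mathcal{X}\times\mathcal{Y}\to\mathbb{R}$ with nonnegative entries and $\sum_{y\in\mathcal{Y}}C(x,y)=1$ for all $x\in\mathcal{X}$; $\mathcal{X}$ is its input set and $\mathcal{Y}$ its output set. Channels are compatible if they have the same input set, and have the same type if they have the same input set and the same output set. Hidden choice (for channels of the same type): $\bigoplus_{i\leftarrow\mu}C_i=\sum_{i\in\mathcal{I}}\mu(i)C_i$. Visible choice (for compatible channels $C_i:\mathcal{X}\times\mathcal{Y}_i\to\mathbb{R}$): $\bigsqcup_{i\leftarrow\mu}C_i$ is the channel with input set $\mathcal{X}$ and output set the disjoint union $\{(y,i)\mid i\in\mathcal{I},y\in\mathcal{Y}_i\}$ given by $(x,(y,j))\mapsto\mu(j)C_j(x,y)$. $\mathbb{D}\mathcal{X}$ is the set of probability distributions on $\mathcal{X}$. A vulnerability is any continuous convex function $\mathbb{V}:\mathbb{D}\mathcal{X}\to\mathbb{R}$. For a prior $\pi\in\mathbb{D}\mathcal{X}$ and a channel $C:\mathcal{X}\times\mathcal{Y}\to\mathbb{R}$, put $p(y)=\sum_{x}\pi(x)C(x,y)$ and, when $p(y)\ne0$, let $p_{X\mid y}\in\mathbb{D}\mathcal{X}$ be $x\mapsto\pi(x)C(x,y)/p(y)$. The posterior vulnerability is $\mathbb{V}[\pi,C]=\sum_{y\in\mathcal{Y},\,p(y)\neq0}p(y)\,\mathbb{V}(p_{X\mid y})$. *)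

theory Defs
  imports "HOL-Analysis.Analysis"
begin

text \<open>
  Input sets and index sets are finite types, so that distributions on them are vectors in a
  Euclidean space and the notions of continuity and convexity of the library apply.
  Output sets are explicit finite sets, since a family of compatible channels
  may have a different output set for each index.
\<close>

definition prob_dists :: "(real ^ 'x::finite) set" where
  "prob_dists = {p. (\<forall>x. 0 \<le> p $ x) \<and> (\<Sum>x\<in>UNIV. p $ x) = 1}"

text \<open>
  \<open>channel Y C\<close> says that the restriction of \<open>C\<close> to \<open>UNIV \<times> Y\<close> is a channel with
  output set \<open>Y\<close>; values \<open>C x y\<close> with \<open>y \<notin> Y\<close> are irrelevant.
\<close>

definition channel :: "'y set \<Rightarrow> ('x::finite \<Rightarrow> 'y \<Rightarrow> real) \<Rightarrow> bool" where
  "channel Y C \<longleftrightarrow> finite Y \<and> Y \<noteq> {} \<and>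
     (\<forall>x. \<forall>y\<in>Y. 0 \<le> C x y) \<and> (\<forall>x. (\<Sum>y\<in>Y. C x y) = 1)"

definition hidden_choice ::
    "real ^ 'i::finite \<Rightarrow> ('i \<Rightarrow> 'x::finite \<Rightarrow> 'y \<Rightarrow> real) \<Rightarrow> 'x \<Rightarrow> 'y \<Rightarrow> real" where
  "hidden_choice \<mu> C = (\<lambda>x y. \<Sum>i\<in>UNIV. \<mu> $ i * C i x y)"

definition visible_outputs :: "('i::finite \<Rightarrow> 'y set) \<Rightarrow> ('y \<times> 'i) set" where
  "visible_outputs Y = {(y, i). y \<in> Y i}"

definition visible_choice ::
    "real ^ 'i::finite \<Rightarrow> ('i \<Rightarrow> 'x::finite \<Rightarrow> 'y \<Rightarrow> real) \<Rightarrow> 'x \<Rightarrow> 'y \<times> 'i \<Rightarrow> real" where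
  "visible_choice \<mu> C = (\<lambda>x (y, j). \<mu> $ j * C j x y)"

text \<open>Only the values of a vulnerability on \<open>prob_dists\<close> matter.\<close>

definition vulnerability :: "(real ^ 'x::finite \<Rightarrow> real) \<Rightarrow> bool" where
  "vulnerability V \<longleftrightarrow> continuous_on prob_dists V \<and> convex_on prob_dists V"

definition output_prob :: "real ^ 'x::finite \<Rightarrow> ('x \<Rightarrow> 'y \<Rightarrow> real) \<Rightarrow> 'y \<Rightarrow> real" where
  "output_prob \<pi> C y = (\<Sum>x\<in>UNIV. \<pi> $ x * C x y)"

definition posterior :: "real ^ 'x::finite \<Rightarrow> ('x \<Rightarrow> 'y \<Rightarrow> real) \<Rightarrow> 'y \<Rightarrow> real ^ 'x" where
  "posterior \<pi> C y = (\<chi> x. \<pi> $ x * C x y / output_prob \<pi> C y)"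

definition posterior_vulnerability ::
    "(real ^ 'x::finite \<Rightarrow> real) \<Rightarrow> real ^ 'x \<Rightarrow> 'y set \<Rightarrow> ('x \<Rightarrow> 'y \<Rightarrow> real) \<Rightarrow> real" where
  "posterior_vulnerability V \<pi> Y C =
     (\<Sum>y\<in>{y \<in> Y. output_prob \<pi> C y \<noteq> 0}. output_prob \<pi> C y * V (posterior \<pi> C y))"

lemma convex_prob_dists: "convex prob_dists"
  by (auto simp: convex_def prob_dists_def sum.distrib simp flip: sum_distrib_left)

lemma posterior_in_prob_dists:
  assumes "\<pi> \<in> prob_dists" "channel Y C" "y \<in> Y" "output_prob \<pi> C y \<noteq> 0"
  shows "posterior \<pi> C y \<in> prob_dists"
  using assms
  by (auto simp: prob_dists_def posterior_def channel_def output_prob_def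
      simp flip: sum_divide_distrib intro!: divide_nonneg_nonneg sum_nonneg)

lemma channel_hidden_choice:
  assumes "\<mu> \<in> prob_dists" "\<And>i. channel Y (C i)"
  shows "channel Y (hidden_choice \<mu> C)"
proof -
  have "(\<Sum>y\<in>Y. \<Sum>i\<in>UNIV. \<mu> $ i * C i x y) = 1" for x
    using assms by (subst sum.swap) (simp add: prob_dists_def channel_def flip: sum_distrib_left)
  then show ?thesis
    using assms by (auto simp: prob_dists_def channel_def hidden_choice_def intro!: sum_nonneg)
qed

lemma visible_outputs_eq: "visible_outputs Y = prod.swap ` Sigma UNIV Y"
  by (auto simp: visible_outputs_def image_iff)

lemma channel_visible_choice:
  assumes "\<mu> \<in> prob_dists" "\<And>i. channel (Y i) (C i)"
  shows "channel (visible_outputs Y) (visible_choice \<mu> C)"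
proof -
  have fin: "finite (Y i)" and ne: "Y i \<noteq> {}" for i
    using assms(2) by (auto simp: channel_def)
  have "(\<Sum>z\<in>visible_outputs Y. visible_choice \<mu> C x z) = 1" for x
  proof -
    have "(\<Sum>z\<in>visible_outputs Y. visible_choice \<mu> C x z)
        = (\<Sum>(i, y)\<in>Sigma UNIV Y. \<mu> $ i * C i x y)"
      unfolding visible_outputs_eq
      by (subst sum.reindex) (auto simp: visible_choice_def intro!: sum.cong)
    also have "\<dots> = (\<Sum>i\<in>UNIV. \<Sum>y\<in>Y i. \<mu> $ i * C i x y)"
      using fin by (subst sum.Sigma) auto
    also have "\<dots> = 1"
      using assms by (simp add: prob_dists_def channel_def flip: sum_distrib_left)
    finally show ?thesis .
  qed
  moreover have "finite (visible_outputs Y)" "visible_outputs Y \<noteq> {}"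
    using fin ne by (auto simp: visible_outputs_eq)
  ultimately show ?thesis
    using assms
    by (auto simp: channel_def visible_choice_def visible_outputs_def prob_dists_def)
qed

end

theory Submission
  imports Defs
begin

text \<open>
  The posterior of a hidden choice at an output \<open>y\<close> is the convex combination of the posteriors of
  the \<open>C\<^sub>i\<close> at \<open>y\<close>, with weights proportional to \<open>\<mu> i\<close> times the probability that \<open>C\<^sub>i\<close> outputs
  \<open>y\<close>; so (a) is Jensen's inequality at each output. The posterior of a visible choice at \<open>(y, i)\<close>
  is the posterior of \<open>C\<^sub>i\<close> at \<open>y\<close>, which gives (b) by summing over outputs.
\<close>

text \<open>An output of probability zero contributes a zero factor, whatever \<open>V\<close>
  returns on its junk posterior, so sums can run over the whole output set.\<close>

lemma posterior_vulnerability_sum: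
  assumes "finite Y"
  shows "posterior_vulnerability V \<pi> Y C = (\<Sum>y\<in>Y. output_prob \<pi> C y * V (posterior \<pi> C y))"
  unfolding posterior_vulnerability_def using assms by (intro sum.mono_neutral_left) auto

lemma output_prob_nonneg:
  assumes "\<pi> \<in> prob_dists" "channel Y C" "y \<in> Y"
  shows "0 \<le> output_prob \<pi> C y"
  using assms by (auto simp: output_prob_def prob_dists_def channel_def intro!: sum_nonneg)

lemma output_prob_visible_choice:
  "output_prob \<pi> (visible_choice \<mu> C) (y, i) = \<mu> $ i * output_prob \<pi> (C i) y"
  by (simp add: output_prob_def visible_choice_def sum_distrib_left mult_ac)

text \<open>The factor \<open>\<mu> $ i\<close> cancels between the joint probability and the output
  probability. At weight zero, division by zero would make the left side the zero vector.\<close>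

lemma posterior_visible_choice:
  assumes "\<mu> $ i \<noteq> 0"
  shows "posterior \<pi> (visible_choice \<mu> C) (y, i) = posterior \<pi> (C i) y"
  unfolding posterior_def output_prob_visible_choice
  using assms by (simp add: vec_eq_iff visible_choice_def)

lemma output_prob_hidden_choice:
  "output_prob \<pi> (hidden_choice \<mu> C) y = (\<Sum>i\<in>UNIV. \<mu> $ i * output_prob \<pi> (C i) y)"
  unfolding output_prob_def hidden_choice_def sum_distrib_left
  by (subst sum.swap) (simp add: mult_ac)

text \<open>This recovers the joint probability without a case split on the output probability: if
  that is zero, a sum of nonnegative terms vanishes, so each term does.\<close>

lemma output_prob_times_posterior:
  assumes "\<pi> \<in> prob_dists" "channel Y C" "y \<in> Y"
  shows "output_prob \<pi> C y * posterior \<pi> C y $ x = \<pi> $ x * C x y"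
proof (cases "output_prob \<pi> C y = 0")
  case True
  have "0 \<le> \<pi> $ x' * C x' y" for x'
    using assms by (auto simp: prob_dists_def channel_def)
  with True have "\<pi> $ x * C x y = 0"
    unfolding output_prob_def by (subst (asm) sum_nonneg_eq_0_iff) auto
  with True show ?thesis
    by simp
qed (simp add: posterior_def)

lemma output_prob_hidden_choice_times_vulnerability_le:
  assumes C: "\<And>i. channel Y (C i)" and \<mu>: "\<mu> \<in> prob_dists" and \<pi>: "\<pi> \<in> prob_dists"
    and V: "convex_on prob_dists V" and y: "y \<in> Y"
  shows "output_prob \<pi> (hidden_choice \<mu> C) y * V (posterior \<pi> (hidden_choice \<mu> C) y)
      \<le> (\<Sum>i\<in>UNIV. \<mu> $ i * (output_prob \<pi> (C i) y * V (posterior \<pi> (C i) y)))"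
proof -
  define P where "P = output_prob \<pi> (hidden_choice \<mu> C) y"
  define w where "w = (\<lambda>i. \<mu> $ i * output_prob \<pi> (C i) y)"
  have w_nonneg: "0 \<le> w i" for i
    using output_prob_nonneg[OF \<pi> C y] \<mu> by (simp add: w_def prob_dists_def)
  have P_eq: "P = sum w UNIV"
    by (simp add: P_def w_def output_prob_hidden_choice)
  have "P * V (posterior \<pi> (hidden_choice \<mu> C) y) \<le> (\<Sum>i\<in>UNIV. w i * V (posterior \<pi> (C i) y))"
  proof (cases "P = 0")
    case True
    \<comment> \<open>Nonnegative weights with total zero all vanish, so both sides of the
      inequality are 0.\<close>
    then have "w i = 0" for i
      using w_nonneg by (simp add: P_eq sum_nonneg_eq_0_iff)
    then show ?thesis
      using True by simp
  next
    case False
    then have "0 < P"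
      using w_nonneg by (simp add: P_eq sum_nonneg less_le)
    \<comment> \<open>Where \<open>w i = 0\<close>, the posterior of \<open>C i\<close> may be a junk value outside \<open>prob_dists\<close>.\<close>
    define S where "S = {i. w i \<noteq> 0}"
    \<comment> \<open>Kept general in \<open>f\<close> because it serves for the total weight, for
      the coordinates of the posteriors and for the values of \<open>V\<close>.\<close>
    have restrict: "(\<Sum>i\<in>S. w i * f i) = (\<Sum>i\<in>UNIV. w i * f i)" for f :: "_ \<Rightarrow> real"
      by (intro sum.mono_neutral_left) (auto simp: S_def)
    have P_S: "sum w S = P"
      using restrict[of "\<lambda>_. 1"] by (simp add: P_eq)
    have "posterior \<pi> (hidden_choice \<mu> C) y $ x = (\<Sum>i\<in>S. (w i / P) *\<^sub>R posterior \<pi> (C i) y) $ x" for x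
    proof -
      \<comment> \<open>Scaling by \<open>P\<close> turns posteriors into joint probabilities, which
        are linear in the channel; dividing by \<open>P\<close> at the end gives the
        mixture.\<close>
      have "P * posterior \<pi> (hidden_choice \<mu> C) y $ x = \<pi> $ x * hidden_choice \<mu> C x y"
        unfolding P_def by (rule output_prob_times_posterior[OF \<pi> channel_hidden_choice[OF \<mu> C] y])
      also have "\<dots> = (\<Sum>i\<in>UNIV. \<mu> $ i * (\<pi> $ x * C i x y))"
        by (simp add: hidden_choice_def sum_distrib_left mult_ac)
      also have "\<dots> = (\<Sum>i\<in>UNIV. w i * posterior \<pi> (C i) y $ x)"
        by (simp add: w_def mult.assoc output_prob_times_posterior[OF \<pi> C y])
      finally show ?thesis
        using False by (simp add: restrict field_simps flip: sum_divide_distrib)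
    qed
    then have post: "posterior \<pi> (hidden_choice \<mu> C) y = (\<Sum>i\<in>S. (w i / P) *\<^sub>R posterior \<pi> (C i) y)"
      by (simp add: vec_eq_iff)
    have "posterior \<pi> (C i) y \<in> prob_dists" if "i \<in> S" for i
      using that by (intro posterior_in_prob_dists[OF \<pi> C y]) (auto simp: S_def w_def)
    moreover have "S \<noteq> {}"
      using P_S False by auto
    \<comment> \<open>Jensen's inequality: the weights \<open>w i / P\<close> are nonnegative and
      sum to 1 over \<open>S\<close>, where every posterior is a genuine distribution.\<close>
    ultimately have "V (posterior \<pi> (hidden_choice \<mu> C) y) \<le> (\<Sum>i\<in>S. (w i / P) * V (posterior \<pi> (C i) y))"
      unfolding post using V False P_S \<open>0 < P\<close> w_nonneg
      by (intro convex_on_sum) (auto simp flip: sum_divide_distrib)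
    also have "\<dots> = (\<Sum>i\<in>UNIV. w i * V (posterior \<pi> (C i) y)) / P"
      by (simp add: restrict flip: sum_divide_distrib)
    finally show ?thesis
      using \<open>0 < P\<close> by (simp add: field_simps)
  qed
  then show ?thesis
    by (simp add: P_def w_def mult.assoc)
qed

lemma posterior_vulnerability_hidden_choice_le:
  assumes C: "\<And>i. channel Y (C i)" and \<mu>: "\<mu> \<in> prob_dists" and \<pi>: "\<pi> \<in> prob_dists"
    and V: "convex_on prob_dists V"
  shows "posterior_vulnerability V \<pi> Y (hidden_choice \<mu> C)
      \<le> (\<Sum>i\<in>UNIV. \<mu> $ i * posterior_vulnerability V \<pi> Y (C i))"
proof -
  have "finite Y"
    using C by (auto simp: channel_def)
  then have "posterior_vulnerability V \<pi> Y (hidden_choice \<mu> C)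
      \<le> (\<Sum>y\<in>Y. \<Sum>i\<in>UNIV. \<mu> $ i * (output_prob \<pi> (C i) y * V (posterior \<pi> (C i) y)))"
    unfolding posterior_vulnerability_sum[OF \<open>finite Y\<close>]
    by (intro sum_mono output_prob_hidden_choice_times_vulnerability_le[OF C \<mu> \<pi> V])
  also have "\<dots> = (\<Sum>i\<in>UNIV. \<mu> $ i * posterior_vulnerability V \<pi> Y (C i))"
    by (subst sum.swap) (simp add: posterior_vulnerability_sum[OF \<open>finite Y\<close>] sum_distrib_left)
  finally show ?thesis .
qed

text \<open>Outputs carry their index, so the sum splits by index with no mixing of posteriors, and
  equality holds term by term.\<close>

lemma posterior_vulnerability_visible_choice:
  assumes fin: "\<And>i. finite (Y i)"
  shows "posterior_vulnerability V \<pi> (visible_outputs Y) (visible_choice \<mu> C)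
      = (\<Sum>i\<in>UNIV. \<mu> $ i * posterior_vulnerability V \<pi> (Y i) (C i))"
proof -
  let ?C = "visible_choice \<mu> C"
  have "finite (visible_outputs Y)"
    using fin by (simp add: visible_outputs_eq)
  then have "posterior_vulnerability V \<pi> (visible_outputs Y) ?C
      = (\<Sum>z\<in>visible_outputs Y. output_prob \<pi> ?C z * V (posterior \<pi> ?C z))"
    by (rule posterior_vulnerability_sum)
  also have "\<dots> = (\<Sum>(i, y)\<in>Sigma UNIV Y. output_prob \<pi> ?C (y, i) * V (posterior \<pi> ?C (y, i)))"
    unfolding visible_outputs_eq by (subst sum.reindex) (auto intro!: sum.cong)
  also have "\<dots> = (\<Sum>i\<in>UNIV. \<Sum>y\<in>Y i. output_prob \<pi> ?C (y, i) * V (posterior \<pi> ?C (y, i)))"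
    using fin by (subst sum.Sigma) auto
  also have "\<dots> = (\<Sum>i\<in>UNIV. \<Sum>y\<in>Y i. \<mu> $ i * (output_prob \<pi> (C i) y * V (posterior \<pi> (C i) y)))"
  proof (intro sum.cong refl)
    fix i y
    show "output_prob \<pi> ?C (y, i) * V (posterior \<pi> ?C (y, i))
        = \<mu> $ i * (output_prob \<pi> (C i) y * V (posterior \<pi> (C i) y))"
      \<comment> \<open>At weight zero the two posteriors may differ, but the factor
        \<open>\<mu> $ i\<close> makes both sides 0.\<close>
      by (cases "\<mu> $ i = 0") (simp_all add: output_prob_visible_choice posterior_visible_choice)
  qed
  also have "\<dots> = (\<Sum>i\<in>UNIV. \<mu> $ i * posterior_vulnerability V \<pi> (Y i) (C i))"
    by (simp add: posterior_vulnerability_sum[OF fin] sum_distrib_left)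
  finally show ?thesis .
qed

theorem theorem7:
  fixes \<mu> :: "real ^ 'i::finite"
    and \<pi> :: "real ^ 'x::finite"
    and V :: "real ^ 'x \<Rightarrow> real"
    and Y :: "'i \<Rightarrow> 'y set"
    and C :: "'i \<Rightarrow> 'x \<Rightarrow> 'y \<Rightarrow> real"
  assumes "\<And>i. channel (Y i) (C i)"
    and "\<mu> \<in> prob_dists"
    and "\<pi> \<in> prob_dists"
    and "vulnerability V"
  shows "(\<forall>Z. (\<forall>i. Y i = Z) \<longrightarrow>
            posterior_vulnerability V \<pi> Z (hidden_choice \<mu> C)
              \<le> (\<Sum>i\<in>UNIV. \<mu> $ i * posterior_vulnerability V \<pi> (Y i) (C i)))
       \<and> posterior_vulnerability V \<pi> (visible_outputs Y) (visible_choice \<mu> C)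
           = (\<Sum>i\<in>UNIV. \<mu> $ i * posterior_vulnerability V \<pi> (Y i) (C i))"
proof (intro conjI allI impI)
  fix Z
  assume "\<forall>i. Y i = Z"
  then have Y: "Y i = Z" for i
    by blast
  have "channel Z (C i)" for i
    using assms(1)[of i] by (simp add: Y)
  moreover have "convex_on prob_dists V"
    using assms(4) by (simp add: vulnerability_def)
  ultimately show "posterior_vulnerability V \<pi> Z (hidden_choice \<mu> C)
      \<le> (\<Sum>i\<in>UNIV. \<mu> $ i * posterior_vulnerability V \<pi> (Y i) (C i))"
    unfolding Y using assms(2,3) by (intro posterior_vulnerability_hidden_choice_le)
next
  show "posterior_vulnerability V \<pi> (visible_outputs Y) (visible_choice \<mu> C)
      = (\<Sum>i\<in>UNIV. \<mu> $ i * posterior_vulnerability V \<pi> (Y i) (C i))"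
    using assms(1) by (intro posterior_vulnerability_visible_choice) (auto simp: channel_def)
qed

end
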